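(* Fix $\mathbf{a}\in\mathbb{R}^{n_{\mathrm e}}_{\ge0}$, $\omega>0$ and $\mathbf{Q}\in\mathbb{R}^{n_{\mathrm{dof}}\times q}$, and set $\underline{\lambda}:=\omega^2$ and $\mathbf{S}:=\mathbf{K}(\mathbf{a})-\underline{\lambda}\mathbf{M}(\mathbf{a})$. Let $d_{\mathrm R}:=\lambda_{\max}(\mathbf{Q}^{\mathsf T}\mathbf{S}^{\dagger}\mathbf{Q})$ be the worst-case dynamic compliance, and assume that $d_{\mathrm R}>0$ and that $$\begin{pmatrix}d_{\mathrm R}\mathbf{I}_q & -\mathbf{Q}^{\mathsf T}\\ -\mathbf{Q} & \mathbf{K}(\mathbf{a})-\omega^2\mathbf{M}(\mathbf{a})\end{pmatrix}\succeq\mathbf{0}.$$ Let $\mathbf{r}_q\in\mathbb{R}^q$ be a unit eigenvector of $\mathbf{Q}^{\mathsf T}\mathbf{S}^{\dagger}\mathbf{Q}$ associated with its largest eigenvalue, and let $\mathbf{f}_{\mathrm R}=\mathbf{Q}\mathbf{r}_q$ (the worst-case load) and $\mathbf{u}_{\mathrm R}:=\mathbf{S}^{\dagger}\mathbf{f}_{\mathrm R}$. Then $\mathbf{u}_{\mathrm R}\neq\mathbf{0}$ and $$\mathbf{K}(\mathbf{a})\mathbf{u}_{\mathrm R}=\underline{\lambda}\Big(\mathbf{M}(\mathbf{a})+\frac{1}{\underline{\lambda}d_{\mathrm R}}\mathbf{Q}\mathbf{Q}^{\mathsf T}\Big)\mathbf{u}_{\mathrm R},$$ i.e., $\mathbf{u}_{\mathrm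 R}$ is an eigenvector of the generalized eigenvalue problem $\mathbf{K}(\mathbf{a})\mathbf{w}=\mu\big(\mathbf{M}(\mathbf{a})+\frac{1}{\underline{\lambda}d_{\mathrm R}}\mathbf{Q}\mathbf{Q}^{\mathsf T}\big)\mathbf{w}$, and it is associated with the smallest positive eigenvalue $\mu=\underline{\lambda}$ of this problem.
   Context: For $\mathbf{a}\in\mathbb{R}^{n_{\mathrm e}}_{\ge 0}$ the stiffness and mass matrices are $\mathbf{K}(\mathbf{a})=\sum_{e=1}^{n_{\mathrm e}}\big[a_e\mathbf{K}^{(1)}_e+a_e^2\mathbf{K}^{(2)}_e+a_e^3\mathbf{K}^{(3)}_e\big]$ and $\mathbf{M}(\mathbf{a})=\mathbf{M}^{(0)}+\sum_{e=1}^{n_{\mathrm e}}a_e\mathbf{M}^{(1)}_e$, where all $\mathbf{K}^{(i)}_e$, $\mathbf{M}^{(0)}$, $\mathbf{M}^{(1)}_e$ are fixed real symmetric positive semidefinite $n_{\mathrm{dof}}\times n_{\mathrm{dof}}$ matrices. $\mathbf{A}\succeq\mathbf{0}$ means that the real symmetric matrix $\mathbf{A}$ is positive semidefinite, $(\cdot)^{\dagger}$ is the Moore-Penrose pseudoinverse, $\lambda_{\max}$ the largest eigenvalue, $\mathbf{I}_q$ the $q\times q$ identity. Eigenvalues of a generalized problem $\mathbf{K}\mathbf{w}=\mu\tilde{\mathbf{M}}\mathbf{w}$ with $\mathbf{K},\tilde{\mathbf{M}}\succeq\mathbf{0}$ are understood with eigenvectors $\mathbf{w}\notin\ker\tilde{\mathbf{M}}$.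 *)

theory Defs
  imports "HOL-Analysis.Analysis"
begin

definition psd :: "real^'n^'n \<Rightarrow> bool" where
  "psd A \<longleftrightarrow> transpose A = A \<and> (\<forall>x. 0 \<le> x \<bullet> (A *v x))"

definition eigenpair :: "real^'n^'n \<Rightarrow> real \<Rightarrow> real^'n \<Rightarrow> bool" where
  "eigenpair A \<mu> v \<longleftrightarrow> v \<noteq> 0 \<and> A *v v = \<mu> *\<^sub>R v"

text \<open>Real eigenvalues only; used for symmetric matrices, whose spectrum is real. For those the set
  below is finite and nonempty (see \<open>lambda_max_symmetric\<close>), so that the maximum is attained.\<close>

definition lambda_max :: "real^'n^'n \<Rightarrow> real" where
  "lambda_max A = Max {\<mu>. \<exists>v. eigenpair A \<mu> v}"

definition penrose_inverse :: "real^'n^'m \<Rightarrow> real^'m^'n \<Rightarrow> bool" where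
  "penrose_inverse A X \<longleftrightarrow>
     A ** X ** A = A \<and> X ** A ** X = X \<and>
     transpose (A ** X) = A ** X \<and> transpose (X ** A) = X ** A"

text \<open>Well defined by \<open>penrose_inverse_ex1\<close> below.\<close>

definition pinv :: "real^'n^'m \<Rightarrow> real^'m^'n" where
  "pinv A = (THE X. penrose_inverse A X)"

definition block_matrix ::
  "real^'a^'c \<Rightarrow> real^'b^'c \<Rightarrow> real^'a^'d \<Rightarrow> real^'b^'d \<Rightarrow> real^('a + 'b)^('c + 'd)" where
  "block_matrix A B C D = (\<chi> i j.
     case i of
       Inl k \<Rightarrow> (case j of Inl l \<Rightarrow> A $ k $ l | Inr l \<Rightarrow> B $ k $ l)
     | Inr k \<Rightarrow> (case j of Inl l \<Rightarrow> C $ k $ l | Inr l \<Rightarrow> D $ k $ l))"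

text \<open>Eigenvectors of \<open>K w = \<mu> M w\<close> are required to lie outside the kernel of \<open>M\<close>, which for
  singular \<open>M\<close> is stronger than \<open>w \<noteq> 0\<close>.\<close>

definition gen_eigenpair :: "real^'n^'n \<Rightarrow> real^'n^'n \<Rightarrow> real \<Rightarrow> real^'n \<Rightarrow> bool" where
  "gen_eigenpair K M \<mu> w \<longleftrightarrow> M *v w \<noteq> 0 \<and> K *v w = \<mu> *\<^sub>R (M *v w)"

definition gen_eigenvalue :: "real^'n^'n \<Rightarrow> real^'n^'n \<Rightarrow> real \<Rightarrow> bool" where
  "gen_eigenvalue K M \<mu> \<longleftrightarrow> (\<exists>w. gen_eigenpair K M \<mu> w)"

definition smallest_pos_gen_eigenvalue :: "real^'n^'n \<Rightarrow> real^'n^'n \<Rightarrow> real \<Rightarrow> bool" where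
  "smallest_pos_gen_eigenvalue K M \<mu> \<longleftrightarrow>
     0 < \<mu> \<and> gen_eigenvalue K M \<mu> \<and> (\<forall>\<nu>. 0 < \<nu> \<and> gen_eigenvalue K M \<nu> \<longrightarrow> \<mu> \<le> \<nu>)"

definition stiffness ::
  "('e::finite \<Rightarrow> real^'n^'n) \<Rightarrow> ('e \<Rightarrow> real^'n^'n) \<Rightarrow> ('e \<Rightarrow> real^'n^'n) \<Rightarrow> real^'e \<Rightarrow> real^'n^'n"
  where
  "stiffness K1 K2 K3 a =
     (\<Sum>e\<in>UNIV. (a $ e) *\<^sub>R K1 e + (a $ e)^2 *\<^sub>R K2 e + (a $ e)^3 *\<^sub>R K3 e)"

definition mass ::
  "real^'n^'n \<Rightarrow> ('e::finite \<Rightarrow> real^'n^'n) \<Rightarrow> real^'e \<Rightarrow> real^'n^'n" where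
  "mass M0 M1 a = M0 + (\<Sum>e\<in>UNIV. (a $ e) *\<^sub>R M1 e)"

lemma inner_mult_transpose: "x \<bullet> (A *v y) = (transpose A *v x) \<bullet> (y::real^'n)"
  by (simp add: dot_lmul_matrix[symmetric])

lemma symmetricI:
  fixes A :: "real^'n^'n"
  assumes "\<And>x y. (A *v x) \<bullet> y = x \<bullet> (A *v y)"
  shows "transpose A = A"
proof -
  have "(transpose A *v x - A *v x) \<bullet> y = 0" for x y
    using assms[of x y] by (simp add: inner_diff_left inner_mult_transpose)
  then have "transpose A *v x = A *v x" for x
    by (metis inner_eq_zero_iff right_minus_eq)
  then show ?thesis
    by (simp add: matrix_eq)
qed

lemma penrose_inverse_unique:
  assumes X: "penrose_inverse A X" and Y: "penrose_inverse A Y"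
  shows "X = Y"
proof -
  have AXAY: "A ** X = A ** Y"
  proof -
    have "A ** X = transpose (A ** Y ** A ** X)"
      using X Y unfolding penrose_inverse_def by simp
    also have "\<dots> = transpose (A ** X) ** transpose (A ** Y)"
      by (simp add: matrix_transpose_mul[symmetric] matrix_mul_assoc)
    also have "\<dots> = A ** X ** A ** Y"
      using X Y unfolding penrose_inverse_def by (simp add: matrix_mul_assoc)
    also have "\<dots> = A ** Y"
      using X unfolding penrose_inverse_def by simp
    finally show ?thesis .
  qed
  have XAYA: "X ** A = Y ** A"
  proof -
    have "X ** A = transpose (X ** (A ** Y ** A))"
      using X Y unfolding penrose_inverse_def by simp
    also have "\<dots> = transpose (Y ** A) ** transpose (X ** A)"
      by (simp add: matrix_transpose_mul[symmetric] matrix_mul_assoc)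
    also have "\<dots> = Y ** A ** X ** A"
      using X Y unfolding penrose_inverse_def by (simp add: matrix_mul_assoc)
    also have "\<dots> = Y ** A"
      using X unfolding penrose_inverse_def by (metis matrix_mul_assoc)
    finally show ?thesis .
  qed
  have "X = X ** A ** X"
    using X unfolding penrose_inverse_def by simp
  also have "\<dots> = Y ** A ** Y"
    by (metis AXAY XAYA matrix_mul_assoc)
  also have "\<dots> = Y"
    using Y unfolding penrose_inverse_def by simp
  finally show ?thesis .
qed

lemma penrose_inverse_exists:
  fixes A :: "real^'n^'m"
  shows "\<exists>X. penrose_inverse A X"
proof -
  define R where "R = range ((*v) A)"
  define N where "N = {k. A *v k = 0}"
  define P where "P y x \<longleftrightarrow> (\<forall>k\<in>N. x \<bullet> k = 0) \<and> (\<forall>v. (y - A *v x) \<bullet> (A *v v) = 0)" for y x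
  have subR: "subspace R"
    unfolding R_def by (simp add: linear_subspace_image)
  have subN: "subspace N"
    unfolding N_def subspace_def
    by (simp add: matrix_vector_right_distrib matrix_vector_mult_scaleR)
  have ex: "\<exists>x. P y x" for y
  proof -
    obtain p z where p: "p \<in> span R" and z: "\<And>w. w \<in> span R \<Longrightarrow> orthogonal z w" and y: "y = p + z"
      using orthogonal_subspace_decomp_exists[of R y] by metis
    obtain x where x: "p = A *v x"
      using p subR by (metis R_def imageE span_eq_iff)
    obtain k x' where k: "k \<in> span N" and x': "\<And>w. w \<in> span N \<Longrightarrow> orthogonal x' w"
      and xk: "x = k + x'"
      using orthogonal_subspace_decomp_exists[of N x] by metis
    have "A *v k = 0"
      using k subN by (metis (mono_tags) N_def mem_Collect_eq span_eq_iff)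
    then have "A *v x' = p"
      by (simp add: x xk matrix_vector_right_distrib)
    moreover have "z \<bullet> (A *v v) = 0" for v
      using z[of "A *v v"] by (simp add: R_def orthogonal_def span_base)
    ultimately have "P y x'"
      unfolding P_def using x' by (auto simp: y orthogonal_def span_base)
    then show ?thesis ..
  qed
  have uniq: "x = x'" if "P y x" "P y x'" for y x x'
  proof -
    have "(A *v x - A *v x') \<bullet> (A *v v) = (y - A *v x') \<bullet> (A *v v) - (y - A *v x) \<bullet> (A *v v)" for v
      by (simp add: inner_diff_left)
    then have "(A *v x - A *v x') \<bullet> (A *v v) = 0" for v
      using that by (simp add: P_def)
    from this[of "x - x'"] have "A *v (x - x') = 0"
      by (simp add: matrix_vector_mult_diff_distrib)
    then have mem: "x - x' \<in> N" by (simp add: N_def)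
    have "x \<bullet> (x - x') = 0" "x' \<bullet> (x - x') = 0"
      using that mem unfolding P_def by blast+
    then have "(x - x') \<bullet> (x - x') = 0"
      by (simp add: inner_diff_left)
    then show ?thesis by simp
  qed
  define g where "g y = (SOME x. P y x)" for y
  have gP: "P y (g y)" for y
    unfolding g_def using ex by (rule someI_ex)
  have gI: "g y = x" if "P y x" for y x
    using uniq gP that by blast
  have lin: "linear g"
  proof (rule linearI)
    fix y z
    have "(y + z - A *v (g y + g z)) \<bullet> w = (y - A *v g y) \<bullet> w + (z - A *v g z) \<bullet> w" for w
      by (simp add: matrix_vector_right_distrib inner_add_left inner_diff_left)
    then show "g (y + z) = g y + g z"
      using gP[of y] gP[of z] by (intro gI) (simp add: P_def inner_add_left)
  next
    fix c y
    have "(c *\<^sub>R y - A *v (c *\<^sub>R g y)) \<bullet> w = c * ((y - A *v g y) \<bullet> w)" for w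
      by (simp add: matrix_vector_mult_scaleR inner_diff_left algebra_simps)
    then show "g (c *\<^sub>R y) = c *\<^sub>R g y"
      using gP[of y] by (intro gI) (simp add: P_def)
  qed
  define X where "X = matrix g"
  have X: "X *v y = g y" for y
    unfolding X_def using lin by (simp add: matrix_works)
  have AgA: "A *v g (A *v v) = A *v v" for v
  proof -
    have "(A *v v - A *v g (A *v v)) \<bullet> (A *v (v - g (A *v v))) = 0"
      using gP[of "A *v v"] unfolding P_def by blast
    then show ?thesis by (simp add: matrix_vector_mult_diff_distrib)
  qed
  have gAg: "g (A *v g y) = g y" for y
    using gP[of y] by (intro gI) (simp add: P_def)
  have sym1: "(A *v g y) \<bullet> z = (A *v g y) \<bullet> (A *v g z)" for y z
  proof -
    have "(z - A *v g z) \<bullet> (A *v g y) = 0"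
      using gP[of z] unfolding P_def by blast
    then have "z \<bullet> (A *v g y) = (A *v g z) \<bullet> (A *v g y)"
      by (simp only: inner_diff_left right_minus_eq)
    then show ?thesis
      by (simp only: inner_commute[of z] inner_commute[of "A *v g z"])
  qed
  have sym2: "g (A *v v) \<bullet> w = g (A *v v) \<bullet> g (A *v w)" for v w
  proof -
    have "w - g (A *v w) \<in> N"
      by (simp add: N_def matrix_vector_mult_diff_distrib AgA)
    then have "g (A *v v) \<bullet> (w - g (A *v w)) = 0"
      using gP[of "A *v v"] unfolding P_def by blast
    then show ?thesis by (simp add: inner_diff_right)
  qed
  have "A ** X ** A = A" "X ** A ** X = X"
    by (simp_all add: matrix_eq matrix_vector_mul_assoc[symmetric] X AgA gAg)
  moreover have "transpose (A ** X) = A ** X"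
  proof (rule symmetricI)
    fix y z
    have "(A *v g y) \<bullet> z = y \<bullet> (A *v g z)"
      using sym1[of y z] sym1[of z y] by (simp add: inner_commute)
    then show "((A ** X) *v y) \<bullet> z = y \<bullet> ((A ** X) *v z)"
      by (simp add: matrix_vector_mul_assoc[symmetric] X)
  qed
  moreover have "transpose (X ** A) = X ** A"
  proof (rule symmetricI)
    fix v w
    have "g (A *v v) \<bullet> w = v \<bullet> g (A *v w)"
      using sym2[of v w] sym2[of w v] by (simp add: inner_commute)
    then show "((X ** A) *v v) \<bullet> w = v \<bullet> ((X ** A) *v w)"
      by (simp add: matrix_vector_mul_assoc[symmetric] X)
  qed
  ultimately show ?thesis unfolding penrose_inverse_def by blast
qed

lemma penrose_inverse_ex1: "\<exists>!X. penrose_inverse A X"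
  using penrose_inverse_exists penrose_inverse_unique by blast

lemma pinv_penrose_inverse: "penrose_inverse A (pinv A)"
  unfolding pinv_def by (rule theI'[OF penrose_inverse_ex1])

lemma symmetric_eigenvalues_finite:
  fixes A :: "real^'n^'n"
  assumes A: "transpose A = A"
  shows "finite {\<mu>. \<exists>v. eigenpair A \<mu> v}"
proof -
  let ?E = "{\<mu>. \<exists>v. eigenpair A \<mu> v}"
  define f where "f \<mu> = (SOME v. eigenpair A \<mu> v)" for \<mu>
  have f: "eigenpair A \<mu> (f \<mu>)" if "\<mu> \<in> ?E" for \<mu>
    using that unfolding f_def by (auto intro: someI_ex)
  have orth: "f \<mu> \<bullet> f \<nu> = 0" if "\<mu> \<in> ?E" "\<nu> \<in> ?E" "\<mu> \<noteq> \<nu>" for \<mu> \<nu>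
  proof -
    have "f \<mu> \<bullet> (A *v f \<nu>) = (A *v f \<mu>) \<bullet> f \<nu>"
      using A by (simp add: inner_mult_transpose)
    then have "\<nu> * (f \<mu> \<bullet> f \<nu>) = \<mu> * (f \<mu> \<bullet> f \<nu>)"
      using f[OF that(1)] f[OF that(2)] by (simp add: eigenpair_def)
    then show ?thesis using that(3) by simp
  qed
  have inj: "inj_on f ?E"
  proof (rule inj_onI)
    fix \<mu> \<nu> assume *: "\<mu> \<in> ?E" "\<nu> \<in> ?E" "f \<mu> = f \<nu>"
    then show "\<mu> = \<nu>"
      using orth[OF *(1,2)] f[OF *(1)] by (auto simp: eigenpair_def)
  qed
  have "pairwise orthogonal (f ` ?E)"
    unfolding pairwise_def orthogonal_def using orth by blast
  moreover have "0 \<notin> f ` ?E"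
  proof
    assume "0 \<in> f ` ?E"
    then obtain \<mu> where \<mu>: "\<mu> \<in> ?E" "f \<mu> = 0" by (metis (no_types, lifting) imageE)
    then show False using f[OF \<mu>(1)] by (simp add: eigenpair_def)
  qed
  ultimately have "finite (f ` ?E)"
    using pairwise_orthogonal_independent independent_bound by blast
  then show ?thesis using inj finite_imageD by blast
qed

lemma symmetric_eigenvalue_exists:
  fixes A :: "real^'n^'n"
  assumes A: "transpose A = A"
  shows "\<exists>\<mu> v. eigenpair A \<mu> v"
proof -
  let ?S = "sphere (0::real^'n) 1"
  have "continuous_on ?S (\<lambda>x. x \<bullet> (A *v x))"
    by (intro continuous_intros linear_continuous_on linear_conv_bounded_linear[THEN iffD1]) simp
  moreover have "?S \<noteq> {}" by simp
  ultimately obtain v where v: "v \<in> ?S" and vmax: "\<And>x. x \<in> ?S \<Longrightarrow> x \<bullet> (A *v x) \<le> v \<bullet> (A *v v)"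
    using continuous_attains_sup[of ?S "\<lambda>x. x \<bullet> (A *v x)"] by auto
  define m where "m = v \<bullet> (A *v v)"
  have nv: "v \<bullet> v = 1" using v by (simp add: dot_square_norm)
  have le: "x \<bullet> (A *v x) \<le> m * (x \<bullet> x)" for x
  proof (cases "x = 0")
    case False
    define y where "y = (1 / norm x) *\<^sub>R x"
    have xy: "x = norm x *\<^sub>R y" using False by (simp add: y_def)
    have "y \<in> ?S" using False by (simp add: y_def)
    then have "y \<bullet> (A *v y) \<le> m" using vmax by (simp add: m_def)
    moreover have "x \<bullet> (A *v x) = norm x ^ 2 * (y \<bullet> (A *v y))"
      by (subst (1 2) xy) (simp add: matrix_vector_mult_scaleR power2_eq_square)
    ultimately show ?thesis
      by (simp add: dot_square_norm mult.commute mult_right_mono)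
  qed simp
  define w where "w = m *\<^sub>R v - A *v v"
  define c where "c = m * (w \<bullet> w) - w \<bullet> (A *v w)"
  have key: "2 * s * (w \<bullet> w) \<le> s\<^sup>2 * c" for s
  proof -
    have sym: "w \<bullet> (A *v v) = v \<bullet> (A *v w)"
      using A by (metis inner_commute inner_mult_transpose)
    have ww: "w \<bullet> w = m * (w \<bullet> v) - w \<bullet> (A *v v)"
      by (subst (2) w_def) (simp add: inner_diff_right)
    have "0 \<le> m * ((v - s *\<^sub>R w) \<bullet> (v - s *\<^sub>R w)) - (v - s *\<^sub>R w) \<bullet> (A *v (v - s *\<^sub>R w))"
      using le[of "v - s *\<^sub>R w"] by simp
    also have "\<dots> = s\<^sup>2 * c - 2 * s * (m * (w \<bullet> v) - w \<bullet> (A *v v))"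
      using sym nv m_def
      by (simp add: matrix_vector_mult_diff_distrib matrix_vector_mult_scaleR inner_diff_left
          inner_diff_right c_def power2_eq_square algebra_simps inner_commute[of v w])
    finally show ?thesis using ww by simp
  qed
  have "w \<bullet> w = 0"
  proof (rule ccontr)
    assume "w \<bullet> w \<noteq> 0"
    then have pos: "0 < w \<bullet> w" by simp
    define s where "s = (w \<bullet> w) / (\<bar>c\<bar> + 1)"
    have s: "0 < s" using pos by (simp add: s_def)
    have "s * (2 * (w \<bullet> w)) \<le> s * (s * c)"
      using key[of s] by (simp add: power2_eq_square algebra_simps)
    then have "2 * (w \<bullet> w) \<le> s * c" using s by simp
    also have "\<dots> \<le> s * (\<bar>c\<bar> + 1)" using s by (intro mult_left_mono) auto
    also have "\<dots> = w \<bullet> w" by (simp add: s_def)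
    finally show False using pos by simp
  qed
  then have "A *v v = m *\<^sub>R v" by (simp add: w_def)
  moreover have "v \<noteq> 0" using nv by auto
  ultimately show ?thesis unfolding eigenpair_def by blast
qed

lemma lambda_max_symmetric:
  fixes A :: "real^'n^'n"
  assumes "transpose A = A"
  shows "\<exists>v. eigenpair A (lambda_max A) v"
    and "eigenpair A \<mu> v \<Longrightarrow> \<mu> \<le> lambda_max A"
proof -
  have "{\<mu>. \<exists>v. eigenpair A \<mu> v} \<noteq> {}"
    using symmetric_eigenvalue_exists[OF assms] by auto
  then show "\<exists>v. eigenpair A (lambda_max A) v"
    unfolding lambda_max_def using Max_in[OF symmetric_eigenvalues_finite[OF assms]] by blast
  show "eigenpair A \<mu> v \<Longrightarrow> \<mu> \<le> lambda_max A"
    unfolding lambda_max_def using symmetric_eigenvalues_finite[OF assms] by (auto intro!: Max_ge)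
qed

end

theory Submission
  imports Defs
begin

text \<open>Write \<open>K\<close>, \<open>M\<close> for the stiffness and mass matrices at \<open>a\<close>, \<open>S = K - \<lambda> M\<close>, \<open>d\<close> for the
  worst-case compliance and \<open>M' = M + Q Q\<^sup>T / (\<lambda> d)\<close>. Everything follows from one half of the Schur
  complement lemma: evaluating the semidefinite block matrix at \<open>(Q\<^sup>T w / d, w)\<close> gives
  \<open>w \<bullet> S w \<ge> \<bar>Q\<^sup>T w\<bar>\<^sup>2 / d\<close> for every \<open>w\<close> (lemma \<open>psd_block_schur\<close>). This inequality is used twice.

  Applied to \<open>w \<in> ker S\<close>, it yields \<open>Q\<^sup>T w = 0\<close>; hence the columns of \<open>Q\<close> lie in the range of \<open>S\<close>
  and \<open>S S\<^sup>\<dagger> Q = Q\<close> (lemma \<open>pinv_solves_of_kernel\<close>). So \<open>u = S\<^sup>\<dagger> Q r\<close> really solves \<open>S u = Q r\<close>, while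
  the eigenvector equation for \<open>r\<close> reads \<open>Q\<^sup>T u = d r\<close>. Eliminating \<open>r\<close> leaves \<open>S u = Q Q\<^sup>T u / d\<close>,
  which is \<open>K u = \<lambda> M' u\<close>; moreover \<open>u \<bullet> M' u > 0\<close> because \<open>Q\<^sup>T u = d r \<noteq> 0\<close>.

  Applied to an eigenvector \<open>w\<close> of the pencil \<open>(K, M')\<close> with eigenvalue \<open>\<nu>\<close>, the same inequality,
  rearranged, says \<open>\<nu> (w \<bullet> M' w) = w \<bullet> K w \<ge> \<lambda> (w \<bullet> M' w)\<close>. As \<open>M'\<close> is semidefinite and \<open>M' w \<noteq> 0\<close>,
  the number \<open>w \<bullet> M' w\<close> is positive (lemma \<open>psd_inner_pos\<close>), so that \<open>\<nu> \<ge> \<lambda>\<close>.\<close>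

lemma transpose_add: "transpose (A + B) = transpose A + transpose (B :: real^'n^'m)"
  by (simp add: transpose_def vec_eq_iff)

lemma transpose_scaleR: "transpose (c *\<^sub>R A) = c *\<^sub>R transpose (A :: real^'n^'m)"
  by (simp add: transpose_def vec_eq_iff)

lemma psd_add: "psd A \<Longrightarrow> psd B \<Longrightarrow> psd (A + B)"
  unfolding psd_def by (simp add: transpose_add matrix_vector_mult_add_rdistrib inner_add_right)

lemma psd_scaleR: "psd A \<Longrightarrow> 0 \<le> c \<Longrightarrow> psd (c *\<^sub>R A)"
  unfolding psd_def by (simp add: transpose_scaleR scaleR_matrix_vector_assoc[symmetric])

lemma psd_zero: "psd 0"
  by (simp add: psd_def transpose_def vec_eq_iff)

lemma psd_sum: "(\<And>i. i \<in> I \<Longrightarrow> psd (A i)) \<Longrightarrow> psd (sum A I)"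
  by (induction I rule: infinite_finite_induct) (auto intro: psd_add psd_zero)

lemma psd_mass:
  assumes "psd M0" "\<And>e. psd (M1 e)" "\<And>e. 0 \<le> a $ e"
  shows "psd (mass M0 M1 a)"
  unfolding mass_def by (intro psd_add psd_sum psd_scaleR assms)

lemma inner_gram: "x \<bullet> ((Q ** transpose Q) *v x) = (norm (transpose Q *v x))\<^sup>2"
  for Q :: "real^'q^'n"
  by (simp add: matrix_vector_mul_assoc[symmetric] dot_lmul_matrix[symmetric]
      power2_norm_eq_inner)

lemma psd_gram: "psd (Q ** transpose Q)" for Q :: "real^'q^'n"
  unfolding psd_def by (simp add: matrix_transpose_mul inner_gram)

text \<open>If the form vanished at \<open>x\<close>, then along the line \<open>x - s A x\<close> it would equal
  \<open>-2 s \<bar>A x\<bar>\<^sup>2 + O(s\<^sup>2)\<close>, which is negative for small \<open>s > 0\<close> unless \<open>A x = 0\<close>.\<close>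

lemma psd_inner_pos:
  assumes A: "psd A" and nz: "A *v x \<noteq> 0"
  shows "0 < x \<bullet> (A *v x)"
proof (rule ccontr)
  assume "\<not> 0 < x \<bullet> (A *v x)"
  then have xx: "x \<bullet> (A *v x) = 0"
    using A by (simp add: psd_def not_less eq_iff)
  define y where "y = A *v x"
  define c where "c = y \<bullet> (A *v y)"
  have c: "0 \<le> c" using A by (simp add: c_def psd_def)
  have yy: "0 < y \<bullet> y" using nz by (simp add: y_def)
  have xy: "x \<bullet> (A *v y) = y \<bullet> y"
    using A by (simp add: psd_def inner_mult_transpose y_def)
  \<comment> \<open>The denominator is increased by one because \<open>c\<close> may vanish.\<close>
  define s where "s = (y \<bullet> y) / (c + 1)"
  have s: "0 < s" using yy c by (simp add: s_def)
  have "0 \<le> (x - s *\<^sub>R y) \<bullet> (A *v (x - s *\<^sub>R y))"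
    using A by (simp add: psd_def)
  also have "\<dots> = s * (s * c - 2 * (y \<bullet> y))"
    using xx xy by (simp add: matrix_vector_mult_diff_distrib matrix_vector_mult_scaleR
        inner_diff_left inner_diff_right c_def[symmetric] y_def[symmetric] algebra_simps)
  finally have "2 * (y \<bullet> y) \<le> s * c"
    using s by (simp add: zero_le_mult_iff)
  also have "\<dots> \<le> s * (c + 1)" using s by simp
  also have "\<dots> = y \<bullet> y" using c by (simp add: s_def)
  finally show False using yy by simp
qed

definition stack :: "real^'a \<Rightarrow> real^'b \<Rightarrow> real^('a + 'b)" where
  "stack x y = (\<chi> i. case i of Inl k \<Rightarrow> x $ k | Inr l \<Rightarrow> y $ l)"

lemma sum_UNIV_Plus:
  fixes f :: "'a::finite + 'b::finite \<Rightarrow> real"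
  shows "(\<Sum>i\<in>UNIV. f i) = (\<Sum>k\<in>UNIV. f (Inl k)) + (\<Sum>l\<in>UNIV. f (Inr l))"
  unfolding UNIV_Plus_UNIV[symmetric] by (subst sum.Plus) simp_all

lemma inner_stack: "stack x y \<bullet> stack x' y' = x \<bullet> x' + y \<bullet> y'"
  by (simp add: inner_vec_def sum_UNIV_Plus stack_def)

lemma block_matrix_mult_stack:
  "block_matrix A B C D *v stack x y = stack (A *v x + B *v y) (C *v x + D *v y)"
  by (simp add: vec_eq_iff matrix_vector_mult_def sum_UNIV_Plus stack_def block_matrix_def
      split: sum.split)

lemma symmetric_block_matrixD:
  assumes "transpose (block_matrix A B C D) = block_matrix A B C D"
  shows "transpose D = D"
proof -
  have "transpose (block_matrix A B C D) $ Inr i $ Inr j = block_matrix A B C D $ Inr i $ Inr j"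
    for i j using assms by simp
  then show ?thesis
    by (simp add: vec_eq_iff transpose_def block_matrix_def)
qed

text \<open>For fixed \<open>w\<close> the quadratic form of the block matrix at \<open>(x, w)\<close> is
  \<open>d \<bar>x\<bar>\<^sup>2 - 2 x \<bullet> Q\<^sup>T w + w \<bullet> S w\<close>, whose minimum over \<open>x\<close> is attained at \<open>x = Q\<^sup>T w / d\<close>.\<close>

lemma psd_block_schur:
  fixes Q :: "real^'q^'n"
  assumes d: "0 < d"
    and B: "psd (block_matrix (d *\<^sub>R mat 1) (- transpose Q) (- Q) S)"
  shows "(norm (transpose Q *v w))\<^sup>2 / d \<le> w \<bullet> (S *v w)"
proof -
  define y where "y = transpose Q *v w"
  define x where "x = (1 / d) *\<^sub>R y"
  have Qx: "w \<bullet> (Q *v x) = (y \<bullet> y) / d"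
    by (simp add: x_def inner_mult_transpose y_def)
  have neg: "(- A) *v v = - (A *v v)" for A :: "real^'k^'m" and v
    using matrix_vector_mult_diff_rdistrib[of 0 A v] by simp
  have "0 \<le> stack x w \<bullet> (block_matrix (d *\<^sub>R mat 1) (- transpose Q) (- Q) S *v stack x w)"
    using B by (simp add: psd_def)
  also have "\<dots> = d * (x \<bullet> x) - x \<bullet> y - w \<bullet> (Q *v x) + w \<bullet> (S *v w)"
    by (simp add: block_matrix_mult_stack inner_stack neg inner_add_right inner_diff_right
        scaleR_matrix_vector_assoc[symmetric] y_def)
  also have "\<dots> = w \<bullet> (S *v w) - (y \<bullet> y) / d"
    using d Qx by (simp add: x_def)
  finally show ?thesis
    by (simp add: power2_norm_eq_inner y_def)
qed

text \<open>The matrix \<open>I - S S\<^sup>\<dagger>\<close> is the orthogonal projection onto the complement of the range of \<open>S\<close>,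
  which for symmetric \<open>S\<close> is the kernel of \<open>S\<close>. The hypothesis therefore says that \<open>Q\<^sup>T\<close>
  annihilates this projection, and transposing gives \<open>(I - S S\<^sup>\<dagger>) Q = 0\<close>.\<close>

lemma pinv_solves_of_kernel:
  fixes S :: "real^'n^'n" and Q :: "real^'q^'n"
  assumes S: "transpose S = S"
    and ker: "\<And>w. S *v w = 0 \<Longrightarrow> transpose Q *v w = 0"
  shows "S ** pinv S ** Q = Q"
proof -
  define P where "P = S ** pinv S"
  have PS: "P ** S = S" and P: "transpose P = P"
    using pinv_penrose_inverse[of S] by (simp_all add: P_def penrose_inverse_def)
  have "S ** P = S"
    using arg_cong[OF PS, of transpose] by (simp add: matrix_transpose_mul P S)
  then have "S *v (v - P *v v) = 0" for v
    by (simp add: matrix_vector_mult_diff_distrib matrix_vector_mul_assoc)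
  then have "transpose Q *v (v - P *v v) = 0" for v
    by (rule ker)
  then have "transpose Q ** P = transpose Q"
    by (simp add: matrix_eq matrix_vector_mult_diff_distrib matrix_vector_mul_assoc)
  from arg_cong[OF this, of transpose] show ?thesis
    by (simp add: matrix_transpose_mul P P_def[symmetric])
qed

theorem lemma5:
  fixes K1 K2 K3 M1 :: "'e::finite \<Rightarrow> real^'n^'n"
    and M0 :: "real^'n^'n"
    and a :: "real^'e"
    and Q :: "real^'q^'n"
    and \<omega> lam d\<^sub>R :: real
    and S :: "real^'n^'n"
    and r\<^sub>q :: "real^'q"
    and f\<^sub>R u\<^sub>R :: "real^'n"
  assumes "\<And>e. psd (K1 e)" and "\<And>e. psd (K2 e)" and "\<And>e. psd (K3 e)"
    and "psd M0" and "\<And>e. psd (M1 e)"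
    and "\<And>e. 0 \<le> a $ e"
    and "0 < \<omega>"
    and "lam = \<omega>^2"
    and "S = stiffness K1 K2 K3 a - lam *\<^sub>R mass M0 M1 a"
    and "d\<^sub>R = lambda_max (transpose Q ** pinv S ** Q)"
    and "0 < d\<^sub>R"
    and "psd (block_matrix (d\<^sub>R *\<^sub>R mat 1) (- transpose Q)
                           (- Q) (stiffness K1 K2 K3 a - \<omega>^2 *\<^sub>R mass M0 M1 a))"
    and "norm r\<^sub>q = 1"
    and "eigenpair (transpose Q ** pinv S ** Q) (lambda_max (transpose Q ** pinv S ** Q)) r\<^sub>q"
    and "f\<^sub>R = Q *v r\<^sub>q"
    and "u\<^sub>R = pinv S *v f\<^sub>R"
  shows "u\<^sub>R \<noteq> 0
    \<and> stiffness K1 K2 K3 a *v u\<^sub>R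
        = lam *\<^sub>R ((mass M0 M1 a + (1 / (lam * d\<^sub>R)) *\<^sub>R (Q ** transpose Q)) *v u\<^sub>R)
    \<and> gen_eigenpair (stiffness K1 K2 K3 a)
        (mass M0 M1 a + (1 / (lam * d\<^sub>R)) *\<^sub>R (Q ** transpose Q)) lam u\<^sub>R
    \<and> smallest_pos_gen_eigenvalue (stiffness K1 K2 K3 a)
        (mass M0 M1 a + (1 / (lam * d\<^sub>R)) *\<^sub>R (Q ** transpose Q)) lam"
proof -
  define K where "K = stiffness K1 K2 K3 a"
  define M where "M = mass M0 M1 a"
  define M' where "M' = M + (1 / (lam * d\<^sub>R)) *\<^sub>R (Q ** transpose Q)"
  have d: "0 < d\<^sub>R" and lam: "0 < lam"
    using assms by auto
  have S: "S = K - lam *\<^sub>R M"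
    using assms by (simp add: K_def M_def)
  have block: "psd (block_matrix (d\<^sub>R *\<^sub>R mat 1) (- transpose Q) (- Q) S)"
    using assms by simp
  have M: "psd M"
    unfolding M_def using assms by (intro psd_mass)
  have M': "psd M'"
    unfolding M'_def using M d lam by (intro psd_add psd_scaleR psd_gram) auto
  have schur: "(norm (transpose Q *v w))\<^sup>2 / d\<^sub>R \<le> w \<bullet> (S *v w)" for w
    using psd_block_schur[OF d block] .
  have lamM': "lam *\<^sub>R (M' *v w) = lam *\<^sub>R (M *v w) + (1 / d\<^sub>R) *\<^sub>R ((Q ** transpose Q) *v w)" for w
    using lam by (simp add: M'_def matrix_vector_mult_add_rdistrib
        scaleR_matrix_vector_assoc[symmetric] scaleR_add_right)
  have Sw: "S *v w = K *v w - lam *\<^sub>R (M *v w)" for w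
    by (simp add: S matrix_vector_mult_diff_rdistrib scaleR_matrix_vector_assoc[symmetric])
  have QS: "S ** pinv S ** Q = Q"
  proof (rule pinv_solves_of_kernel)
    show "transpose S = S"
      using block symmetric_block_matrixD unfolding psd_def by blast
    fix w assume "S *v w = 0"
    then show "transpose Q *v w = 0"
      using schur[of w] d by (simp add: divide_le_0_iff)
  qed
  have uR: "u\<^sub>R = pinv S *v (Q *v r\<^sub>q)"
    using assms by blast
  have Su: "S *v u\<^sub>R = Q *v r\<^sub>q"
    by (simp add: uR matrix_vector_mul_assoc matrix_mul_assoc QS)
  have eig: "(transpose Q ** pinv S ** Q) *v r\<^sub>q = d\<^sub>R *\<^sub>R r\<^sub>q"
    using assms unfolding eigenpair_def by blast
  have Qu: "transpose Q *v u\<^sub>R = d\<^sub>R *\<^sub>R r\<^sub>q"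
    by (simp add: uR matrix_vector_mul_assoc matrix_mul_assoc eig del: transpose_matrix_vector)
  have r: "r\<^sub>q \<noteq> 0"
    using assms by (simp add: eigenpair_def)
  have Ku: "K *v u\<^sub>R = lam *\<^sub>R (M' *v u\<^sub>R)"
  proof -
    have "(1 / d\<^sub>R) *\<^sub>R ((Q ** transpose Q) *v u\<^sub>R) = Q *v r\<^sub>q"
      using d by (simp add: matrix_vector_mul_assoc[symmetric] Qu matrix_vector_mult_scaleR
          del: transpose_matrix_vector)
    then show ?thesis
      using Su Sw[of u\<^sub>R] by (simp add: lamM' algebra_simps)
  qed
  have u: "u\<^sub>R \<noteq> 0"
    using Qu r d by auto
  have M'u: "M' *v u\<^sub>R \<noteq> 0"
  proof -
    have "0 \<le> u\<^sub>R \<bullet> (M *v u\<^sub>R)"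
      using M by (simp add: psd_def)
    moreover have "0 < (1 / (lam * d\<^sub>R)) * (norm (transpose Q *v u\<^sub>R))\<^sup>2"
      unfolding Qu using r d lam by simp
    ultimately have "0 < u\<^sub>R \<bullet> (M' *v u\<^sub>R)"
      by (simp add: M'_def matrix_vector_mult_add_rdistrib inner_add_right
          scaleR_matrix_vector_assoc[symmetric] inner_gram del: transpose_matrix_vector)
    then show ?thesis by auto
  qed
  have pair: "gen_eigenpair K M' lam u\<^sub>R"
    using Ku M'u by (simp add: gen_eigenpair_def)
  have least: "lam \<le> \<nu>" if "gen_eigenvalue K M' \<nu>" for \<nu>
  proof -
    obtain w where nz: "M' *v w \<noteq> 0" and Kw: "K *v w = \<nu> *\<^sub>R (M' *v w)"
      using \<open>gen_eigenvalue K M' \<nu>\<close> by (auto simp: gen_eigenvalue_def gen_eigenpair_def)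
    have "lam * (w \<bullet> (M' *v w)) = w \<bullet> (lam *\<^sub>R (M' *v w))"
      by simp
    also have "\<dots> = lam * (w \<bullet> (M *v w)) + (norm (transpose Q *v w))\<^sup>2 / d\<^sub>R"
      unfolding lamM' by (simp add: inner_add_right inner_gram del: transpose_matrix_vector)
    also have "\<dots> \<le> w \<bullet> (K *v w)"
      using schur[of w] by (simp add: Sw inner_diff_right)
    also have "\<dots> = \<nu> * (w \<bullet> (M' *v w))"
      by (simp add: Kw)
    finally show ?thesis
      using psd_inner_pos[OF M' nz] by simp
  qed
  have "smallest_pos_gen_eigenvalue K M' lam"
    using lam pair least by (auto simp: smallest_pos_gen_eigenvalue_def gen_eigenvalue_def)
  with u Ku pair show ?thesis
    by (simp add: K_def M_def M'_def)
qed

end
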